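(* Let $a>0$ and $\beta>0$, and let $(P_n)_{n\ge 0}$ be the monic orthogonal polynomials ($\deg P_n=n$) satisfying $$\sum_{k=0}^\infty P_n(k)P_m(k)\,\frac{a^k}{(\beta)_k\,k!}=0,\qquad n\neq m.$$ Let $a_n^2$ and $b_n$ be the coefficients in their three-term recurrence relation $$xP_n(x)=P_{n+1}(x)+b_nP_n(x)+a_n^2P_{n-1}(x),\qquad n\ge 0,$$ with $P_{-1}=0$, $P_0=1$ and $a_0^2=0$. Then $$b_n+b_{n-1}-n+\beta=\frac{an}{a_n^2}\qquad (n\ge 1),$$ $$(a_{n+1}^2-a)(a_n^2-a)=a\,(b_n-n)(b_n-n+\beta-1)\qquad (n\ge 0),$$ with initial conditions $$a_0^2=0,\qquad b_0=\frac{\sqrt a\, I_\beta(2\sqrt a)}{I_{\beta-1}(2\sqrt a)}.$$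
   Context: $(\beta)_k=\beta(\beta+1)\cdots(\beta+k-1)$, with $(\beta)_0=1$, is the Pochhammer symbol. $I_\nu$ is the modified Bessel function $I_\nu(z)=\sum_{k=0}^\infty \frac{(z/2)^{2k+\nu}}{k!\,\Gamma(k+\nu+1)}$ (for $z>0$). The coefficient $a_n^2$ is a notation for the positive recurrence coefficient ($n\ge1$); by convention $a_0^2=0$. *)

theory Defs
  imports "HOL-Analysis.Analysis" "HOL-Computational_Algebra.Polynomial"
begin

text \<open>Modified Bessel function of the first kind, for real argument \<open>z > 0\<close>.\<close>

definition bessel_I :: "real \<Rightarrow> real \<Rightarrow> real" where
  "bessel_I \<nu> z =
     (\<Sum>k. (z / 2) powr (2 * real k + \<nu>) / (fact k * Gamma (real k + \<nu> + 1)))"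

definition charlier_weight :: "real \<Rightarrow> real \<Rightarrow> nat \<Rightarrow> real" where
  "charlier_weight a \<beta> k = a ^ k / (pochhammer \<beta> k * fact k)"

definition monic_orthogonal_polys :: "(nat \<Rightarrow> real) \<Rightarrow> (nat \<Rightarrow> real poly) \<Rightarrow> bool" where
  "monic_orthogonal_polys w P \<longleftrightarrow>
     (\<forall>n. degree (P n) = n \<and> lead_coeff (P n) = 1) \<and>
     (\<forall>n m. n \<noteq> m \<longrightarrow> (\<lambda>k. poly (P n) (real k) * poly (P m) (real k) * w k) sums 0)"

text \<open>
  \<open>A n\<close> stands for the coefficient usually written $a_n^2$; the case split at \<open>n = 0\<close> expresses
  the convention $P_{-1} = 0$.
\<close>

definition recurrence_coeffs ::
    "(nat \<Rightarrow> real poly) \<Rightarrow> (nat \<Rightarrow> real) \<Rightarrow> (nat \<Rightarrow> real) \<Rightarrow> bool" where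
  "recurrence_coeffs P A b \<longleftrightarrow>
     A 0 = 0 \<and>
     (\<forall>n. [:0, 1:] * P n =
            P (n + 1) + smult (b n) (P n) + smult (A n) (if n = 0 then 0 else P (n - 1)))"

end

theory Submission imports Defs begin

text \<open>
  Let \<open>L q = (\<Sum>k. q k * w k)\<close>. The weight satisfies the Pearson equation
  \<open>(k + 1) * (k + \<beta>) * w (k + 1) = a * w k\<close>, i.e. \<open>L (x * (x + \<beta> - 1) * q) = a * L (q (x + 1))\<close>.
  Evaluating \<open>L (P n (x + 1) * P (n - 1))\<close> both through the leading coefficients and through this
  identity gives the first equation. Expanding \<open>L ((x + 1) * P n (x + 1) * P (n - 1))\<close> by the
  three-term recurrence of either factor gives
  \<open>a * n * (b (n - 1) - b n + 1) = A n * (A (n + 1) - A (n - 1))\<close>. Together these say that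
  \<open>(A (n + 1) - a) * (A n - a) - a * (b n - n) * (b n - n + \<beta> - 1)\<close> does not depend on \<open>n\<close>, and
  at \<open>n = 0\<close> it vanishes by the Pearson identity for \<open>q = 1\<close>.
\<close>

section \<open>Leading coefficients under a translation of the variable\<close>

lemma coeff_pcompose_linear_top:
  fixes p :: "'a::comm_ring_1 poly"
  assumes "degree p \<le> m"
  shows "coeff (p \<circ>\<^sub>p [:c, 1:]) m = coeff p m"
  using assms
proof (induction p arbitrary: m)
  case 0
  then show ?case by simp
next
  case (pCons u p)
  show ?case
  proof (cases m)
    case 0
    with pCons.prems have "p = 0" by (simp split: if_splits)
    then show ?thesis by (simp add: pcompose_pCons)
  next
    case (Suc m')
    with pCons.prems have d: "degree p \<le> m'" by (simp split: if_splits)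
    then have "coeff (p \<circ>\<^sub>p [:c, 1:]) (Suc m') = coeff p (Suc m')"
      using pCons.IH by simp
    with d Suc pCons.IH[OF d] show ?thesis
      by (simp add: pcompose_pCons coeff_eq_0)
  qed
qed

text \<open>Only the top monomial contributes to the correction: it is the second term in the
  binomial expansion of \<open>(x + c) ^ Suc m\<close>.\<close>

lemma coeff_pcompose_linear_subtop:
  fixes p :: "'a::comm_ring_1 poly"
  assumes "degree p \<le> Suc m"
  shows "coeff (p \<circ>\<^sub>p [:c, 1:]) m = coeff p m + of_nat (Suc m) * c * coeff p (Suc m)"
  using assms
proof (induction p arbitrary: m)
  case 0
  then show ?case by simp
next
  case (pCons u p)
  then have d: "degree p \<le> m" by (simp split: if_splits)
  then have top: "coeff (p \<circ>\<^sub>p [:c, 1:]) m = coeff p m"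
    by (rule coeff_pcompose_linear_top)
  show ?case
  proof (cases m)
    case 0
    with top show ?thesis by (simp add: pcompose_pCons)
  next
    case (Suc m')
    with d pCons.IH[of m'] top show ?thesis
      by (simp add: pcompose_pCons algebra_simps)
  qed
qed

lemma degree_pcompose_linear [simp]:
  fixes p :: "'a::idom poly"
  shows "degree (p \<circ>\<^sub>p [:c, 1:]) = degree p"
  by (simp add: degree_pcompose)

section \<open>Orthogonal polynomials for a positive weight on the naturals\<close>

locale discrete_orthogonal_polys =
  fixes w :: "nat \<Rightarrow> real" and P :: "nat \<Rightarrow> real poly"
  assumes weight_pos: "w k > 0"
    and orthogonal: "monic_orthogonal_polys w P"
begin

definition L :: "real poly \<Rightarrow> real" where
  "L q = (\<Sum>k. poly q (real k) * w k)"

abbreviation h :: "nat \<Rightarrow> real" where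
  "h n \<equiv> L (P n * P n)"

lemma degree_P [simp]: "degree (P n) = n"
  using orthogonal by (simp add: monic_orthogonal_polys_def)

lemma coeff_P_top [simp]: "coeff (P n) n = 1"
proof -
  have "lead_coeff (P n) = 1" using orthogonal by (simp add: monic_orthogonal_polys_def)
  then show ?thesis by simp
qed

lemma P_nonzero: "P n \<noteq> 0"
  using coeff_P_top[of n] by force

lemma P_0: "P 0 = 1"
proof -
  obtain c where "P 0 = [:c:]" using degree_P[of 0] by (elim degree_eq_zeroE)
  then show ?thesis using coeff_P_top[of 0] by (simp add: one_pCons)
qed

text \<open>Monic polynomials of each degree form a basis: subtracting \<open>coeff q n\<close>
  times \<open>P n\<close> removes the top term. Bounding the degree by vanishing coefficients lets
  \<open>n = 0\<close> mean \<open>q = 0\<close>.\<close>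

lemma poly_span_induct:
  assumes "\<And>i. n \<le> i \<Longrightarrow> coeff q i = 0"
    and "\<And>m. m < n \<Longrightarrow> R (P m)"
    and "R 0" and "\<And>p q. R p \<Longrightarrow> R q \<Longrightarrow> R (p + q)" and "\<And>c p. R p \<Longrightarrow> R (smult c p)"
  shows "R q"
  using assms(1,2)
proof (induction n arbitrary: q)
  case 0
  then have "q = 0" by (intro poly_eqI) simp
  with assms(3) show ?case by simp
next
  case (Suc n)
  let ?r = "q - smult (coeff q n) (P n)"
  have "coeff ?r i = 0" if "n \<le> i" for i
    using that Suc.prems(1)[of i] by (cases "i = n") (auto simp: coeff_eq_0)
  then have "R ?r" by (rule Suc.IH[OF _ Suc.prems(2)[OF less_SucI]])
  moreover have "R (smult (coeff q n) (P n))" by (rule assms(5)[OF Suc.prems(2)[OF lessI]])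
  ultimately have "R (?r + smult (coeff q n) (P n))" by (rule assms(4))
  then show ?case by simp
qed

text \<open>Convergence comes from orthogonality itself, since \<open>sums\<close> includes it. The
  product \<open>P 1 * P 0\<close> is \<open>x + c\<close>, which is eventually at least 1, so its
  series dominates that of \<open>w\<close>.\<close>

lemma summable_weight: "summable w"
proof -
  obtain c d where "P 1 = [:c, d:]"
    using degree_P[of 1] by (metis One_nat_def degree1_coeffs)
  with coeff_P_top[of 1] have P1: "P 1 = [:c, 1:]" by (simp del: coeff_P_top)
  have "(\<lambda>k. poly (P 1) (real k) * poly (P 0) (real k) * w k) sums 0"
    using orthogonal by (simp add: monic_orthogonal_polys_def)
  then have s: "summable (\<lambda>k. (c + real k) * w k)"
    by (simp only: P1) (simp add: P_0 sums_iff)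
  obtain N where N: "1 - c \<le> real N" using real_arch_simple by blast
  show ?thesis
  proof (rule summable_comparison_test'[OF s])
    fix k assume "N \<le> k"
    with N have "1 \<le> c + real k" by linarith
    then show "norm (w k) \<le> (c + real k) * w k"
      using weight_pos[of k] by (simp add: mult_le_cancel_right)
  qed
qed

lemma summable_poly: "summable (\<lambda>k. poly q (real k) * w k)"
proof (rule poly_span_induct[where n = "Suc (degree q)" and q = q])
  fix m
  show "summable (\<lambda>k. poly (P m) (real k) * w k)"
  proof (cases m)
    case 0
    then show ?thesis using summable_weight by (simp add: P_0)
  next
    case (Suc m')
    \<comment> \<open>Pairing with \<open>P 0 = 1\<close> turns orthogonality into convergence for
      \<open>P m\<close> alone.\<close>
    then have "(\<lambda>k. poly (P m) (real k) * poly (P 0) (real k) * w k) sums 0"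
      using orthogonal by (simp add: monic_orthogonal_polys_def)
    then show ?thesis by (simp add: P_0 sums_iff)
  qed
next
  fix c p assume "summable (\<lambda>k. poly p (real k) * w k)"
  then have "summable (\<lambda>k. c * (poly p (real k) * w k))" by (rule summable_mult)
  then show "summable (\<lambda>k. poly (smult c p) (real k) * w k)" by (simp add: mult.assoc)
qed (auto simp: coeff_eq_0 distrib_right intro: summable_add)

lemma L_add: "L (p + q) = L p + L q"
  by (simp add: L_def distrib_right suminf_add summable_poly)

lemma L_smult: "L (smult c p) = c * L p"
  by (simp add: L_def mult.assoc suminf_mult summable_poly)

lemma L_0 [simp]: "L 0 = 0"
  by (simp add: L_def)

lemma L_diff: "L (p - q) = L p - L q"
  using L_add[of "p - q" q] by simp

lemma L_P_P: "n \<noteq> m \<Longrightarrow> L (P n * P m) = 0"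
  using orthogonal by (simp add: monic_orthogonal_polys_def L_def sums_iff)

lemma h_pos: "h n > 0"
proof -
  \<comment> \<open>A nonzero polynomial cannot vanish at every natural number, so some term of the
    nonnegative series is positive.\<close>
  have "finite {x. poly (P n) x = 0}" by (simp add: poly_roots_finite P_nonzero)
  then have "finite (real -` {x. poly (P n) x = 0})"
    by (rule finite_vimageI) (simp add: inj_on_def)
  then obtain k where "k \<notin> real -` {x. poly (P n) x = 0}"
    using ex_new_if_finite infinite_UNIV_nat by blast
  then have "poly (P n * P n) (real k) * w k > 0"
    using weight_pos[of k] by (simp add: zero_less_mult_iff) (meson linorder_neqE_linordered_idom)
  moreover have "poly (P n * P n) (real j) * w j \<ge> 0" for j
    using weight_pos[of j] by (simp add: less_imp_le)
  ultimately show ?thesis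
    unfolding L_def by (intro suminf_pos2[OF summable_poly])
qed

text \<open>After removal of the top term along \<open>P n\<close>, what is left has degree below
  \<open>n\<close> and is orthogonal to \<open>P n\<close>.\<close>

lemma L_P_mult:
  assumes "degree q \<le> n"
  shows "L (P n * q) = coeff q n * h n"
proof -
  let ?r = "q - smult (coeff q n) (P n)"
  have "coeff ?r i = 0" if "n \<le> i" for i
    using that assms by (cases "i = n") (auto simp: coeff_eq_0)
  then have "L (P n * ?r) = 0"
    by (rule poly_span_induct[where n = n]) (auto simp: L_P_P L_add L_smult distrib_left)
  then show ?thesis by (simp add: right_diff_distrib L_diff L_smult)
qed

text \<open>One degree higher: removing the multiple of \<open>P (Suc n)\<close> costs its
  subleading coefficient at position \<open>n\<close>.\<close>

lemma L_P_mult_Suc: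
  assumes "degree q \<le> Suc n"
  shows "L (P n * q) = (coeff q n - coeff q (Suc n) * coeff (P (Suc n)) n) * h n"
proof -
  let ?r = "q - smult (coeff q (Suc n)) (P (Suc n))"
  have "degree ?r \<le> n"
  proof (rule degree_le, intro allI impI)
    fix i assume "n < i"
    then show "coeff ?r i = 0"
      using assms by (cases "i = Suc n") (auto simp: coeff_eq_0)
  qed
  then have "L (P n * ?r) = coeff ?r n * h n" by (rule L_P_mult)
  then show ?thesis by (simp add: right_diff_distrib L_diff L_smult L_P_P)
qed

text \<open>Both sides equal \<open>L (x * P n * P (Suc n))\<close>, with \<open>x\<close> attached
  to one factor or to the other.\<close>

lemma recurrence_A_h:
  assumes "recurrence_coeffs P A b"
  shows "h (Suc n) = A (Suc n) * h n"
proof -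
  have "[:0, 1:] * P (Suc n) = P (n + 2) + smult (b (Suc n)) (P (Suc n)) + smult (A (Suc n)) (P n)"
    using assms by (simp add: recurrence_coeffs_def)
  then have "L (P n * ([:0, 1:] * P (Suc n))) =
      L (P n * (P (n + 2) + smult (b (Suc n)) (P (Suc n)) + smult (A (Suc n)) (P n)))"
    by (simp only:)
  also have "\<dots> = A (Suc n) * h n"
    by (simp add: distrib_left L_add L_smult L_P_P)
  also have "P n * ([:0, 1:] * P (Suc n)) = P (Suc n) * pCons 0 (P n)"
    by (simp add: algebra_simps)
  also have "L \<dots> = h (Suc n)"
    by (subst L_P_mult) (auto simp: degree_pCons_eq_if)
  finally show ?thesis .
qed

lemma recurrence_A_pos:
  assumes "recurrence_coeffs P A b"
  shows "A (Suc n) > 0"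
  using recurrence_A_h[OF assms, of n] h_pos[of n] h_pos[of "Suc n"]
  by (metis zero_less_mult_pos2)

text \<open>Coefficient of \<open>x ^ n\<close> in the recurrence: \<open>b n\<close> is the drop
  between consecutive subleading coefficients.\<close>

lemma recurrence_b_coeff:
  assumes "recurrence_coeffs P A b"
  shows "coeff (P (Suc n)) n = (if n = 0 then 0 else coeff (P n) (n - 1)) - b n"
proof -
  have "coeff ([:0, 1:] * P n) n =
      coeff (P (n + 1) + smult (b n) (P n) + smult (A n) (if n = 0 then 0 else P (n - 1))) n"
    using assms by (simp only: recurrence_coeffs_def)
  then show ?thesis
    by (cases n) (auto simp: coeff_eq_0)
qed

end

section \<open>The weight and its Pearson identity\<close>

lemma charlier_weight_pos: "a > 0 \<Longrightarrow> \<beta> > 0 \<Longrightarrow> charlier_weight a \<beta> k > 0"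
  by (simp add: charlier_weight_def pochhammer_pos)

lemma charlier_weight_Suc:
  assumes "\<beta> > 0"
  shows "(real k + 1) * (real k + \<beta>) * charlier_weight a \<beta> (Suc k) = a * charlier_weight a \<beta> k"
proof -
  have "pochhammer \<beta> k > 0" "\<beta> + real k > 0" using assms by (auto simp: pochhammer_pos)
  then show ?thesis
    by (simp add: charlier_weight_def pochhammer_Suc divide_simps del: of_nat_Suc)
      (simp add: algebra_simps)
qed

locale charlier_polys =
  fixes a \<beta> :: real and P :: "nat \<Rightarrow> real poly" and A b :: "nat \<Rightarrow> real"
  assumes a_pos: "a > 0" and \<beta>_pos: "\<beta> > 0"
    and orth: "monic_orthogonal_polys (charlier_weight a \<beta>) P"
    and rec: "recurrence_coeffs P A b"
begin

sublocale discrete_orthogonal_polys "charlier_weight a \<beta>" P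
  by unfold_locales (simp_all add: charlier_weight_pos a_pos \<beta>_pos orth)

lemma A_0: "A 0 = 0"
  using rec by (simp add: recurrence_coeffs_def)

lemma recurrence_0: "[:0, 1:] = P 1 + [:b 0:]"
proof -
  have "[:0, 1:] * P 0 = P (0 + 1) + smult (b 0) (P 0) + smult (A 0) 0"
    using rec by (simp add: recurrence_coeffs_def)
  then show ?thesis by (simp add: P_0)
qed

lemma recurrence_Suc:
  "[:0, 1:] * P (Suc n) = P (Suc (Suc n)) + smult (b (Suc n)) (P (Suc n)) + smult (A (Suc n)) (P n)"
  using rec by (simp add: recurrence_coeffs_def)

lemma pearson: "L ([:0, \<beta> - 1, 1:] * q) = a * L (q \<circ>\<^sub>p [:1, 1:])"
proof -
  let ?w = "charlier_weight a \<beta>"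
  \<comment> \<open>The quadratic has the factor \<open>x\<close>, so the term at index 0 vanishes
    and the sum may start at 1.\<close>
  have "L ([:0, \<beta> - 1, 1:] * q) =
      (\<Sum>k. poly ([:0, \<beta> - 1, 1:] * q) (real (Suc k)) * ?w (Suc k))"
    unfolding L_def using suminf_split_head[OF summable_poly[of "[:0, \<beta> - 1, 1:] * q"]] by simp
  also have "\<dots> = (\<Sum>k. a * (poly (q \<circ>\<^sub>p [:1, 1:]) (real k) * ?w k))"
  proof (rule suminf_cong)
    fix k
    have "poly ([:0, \<beta> - 1, 1:] * q) (real (Suc k)) * ?w (Suc k) =
        poly q (1 + real k) * ((real k + 1) * (real k + \<beta>) * ?w (Suc k))"
      by (simp add: algebra_simps)
    also have "\<dots> = poly q (1 + real k) * (a * ?w k)"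
      by (simp only: charlier_weight_Suc[OF \<beta>_pos])
    finally show "poly ([:0, \<beta> - 1, 1:] * q) (real (Suc k)) * ?w (Suc k) =
        a * (poly (q \<circ>\<^sub>p [:1, 1:]) (real k) * ?w k)"
      by (simp add: poly_pcompose mult_ac)
  qed
  also have "\<dots> = a * L (q \<circ>\<^sub>p [:1, 1:])"
    unfolding L_def by (rule suminf_mult[OF summable_poly])
  finally show ?thesis .
qed

text \<open>Up to the factor \<open>h m\<close>, this is the coefficient of \<open>P m\<close> when
  \<open>P n (x + 1)\<close> is expanded in the orthogonal basis.\<close>

definition T :: "nat \<Rightarrow> nat \<Rightarrow> real" where
  "T n m = L (P m * (P n \<circ>\<^sub>p [:1, 1:]))"

text \<open>Pearson identity for \<open>q = P n (x) * P m (x - 1)\<close>. The shift moves to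
  \<open>P m\<close>, and the cofactor of \<open>P n\<close> has degree at most
  \<open>m + 2\<close>, so \<open>n = m + 2\<close> and \<open>n = m + 1\<close> need only leading
  coefficients.\<close>

lemma T_pearson: "a * T n m = L (P n * ([:0, \<beta> - 1, 1:] * (P m \<circ>\<^sub>p [:-1, 1:])))"
proof -
  have "P m \<circ>\<^sub>p [:-1, 1:] \<circ>\<^sub>p [:1, 1:] = P m"
    by (simp add: pcompose_pCons flip: pcompose_assoc)
  then have "P m * (P n \<circ>\<^sub>p [:1, 1:]) = (P n * (P m \<circ>\<^sub>p [:-1, 1:])) \<circ>\<^sub>p [:1, 1:]"
    by (simp add: pcompose_mult mult.commute)
  then show ?thesis by (simp add: T_def mult_ac flip: pearson)
qed

lemma degree_shift_quadratic: "degree ([:0, \<beta> - 1, 1:] * (P m \<circ>\<^sub>p [:-1, 1:])) \<le> Suc (Suc m)"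
  using degree_mult_le[of "[:0, \<beta> - 1, 1:]" "P m \<circ>\<^sub>p [:-1, 1:]"] by simp

lemma T_diag: "T n n = h n"
  unfolding T_def by (subst L_P_mult) (simp_all add: coeff_pcompose_linear_top)

lemma T_sub1: "T (Suc n) n = real (Suc n) * h n"
  unfolding T_def
  by (subst L_P_mult_Suc) (simp_all add: coeff_pcompose_linear_top coeff_pcompose_linear_subtop)

lemma T_sub2: "a * T (Suc (Suc n)) n = h (Suc (Suc n))"
  unfolding T_pearson
  by (subst L_P_mult[OF degree_shift_quadratic])
    (simp add: coeff_pcompose_linear_top coeff_eq_0)

text \<open>The subleading coefficients of \<open>P n\<close> and \<open>P (Suc (Suc n))\<close>
  enter as a difference, which telescopes to \<open>b n + b (Suc n)\<close>. The shift by -1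
  contributes \<open>- n\<close>, the quadratic \<open>\<beta> - 1\<close>.\<close>

lemma T_sub1_pearson: "a * T (Suc n) n = (b (Suc n) + b n - real (Suc n) + \<beta>) * h (Suc n)"
proof -
  let ?q = "P n \<circ>\<^sub>p [:-1, 1:]"
  have "coeff ?q n = 1" "coeff ?q (Suc n) = 0"
    by (simp_all add: coeff_pcompose_linear_top coeff_eq_0)
  moreover have "(if n = 0 then 0 else coeff ?q (n - 1)) =
      (if n = 0 then 0 else coeff (P n) (n - 1)) - real n"
    by (cases n) (simp_all add: coeff_pcompose_linear_subtop)
  ultimately have
    "coeff ([:0, \<beta> - 1, 1:] * ?q) (Suc n) =
      \<beta> - 1 + (if n = 0 then 0 else coeff (P n) (n - 1)) - real n"
    "coeff ([:0, \<beta> - 1, 1:] * ?q) (Suc (Suc n)) = 1"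
    by (cases n; simp)+
  then show ?thesis
    unfolding T_pearson
    using recurrence_b_coeff[OF rec, of n] recurrence_b_coeff[OF rec, of "Suc n"]
    by (subst L_P_mult_Suc[OF degree_shift_quadratic]) simp
qed

section \<open>The two nonlinear recurrence equations\<close>

lemma first_equation: "A (Suc n) * (b (Suc n) + b n - real (Suc n) + \<beta>) = a * real (Suc n)"
proof -
  have "(A (Suc n) * (b (Suc n) + b n - real (Suc n) + \<beta>)) * h n =
      (b (Suc n) + b n - real (Suc n) + \<beta>) * h (Suc n)"
    by (simp only: recurrence_A_h[OF rec] mult_ac)
  also have "\<dots> = (a * real (Suc n)) * h n"
    by (simp only: T_sub1 mult.assoc flip: T_sub1_pearson)
  finally show ?thesis using h_pos[of n] by (metis less_irrefl mult_right_cancel)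
qed

lemma compatibility:
  "a * real (Suc n) * (b n - b (Suc n) + 1) = A (Suc n) * (A (Suc (Suc n)) - A n)"
proof -
  let ?E = "\<lambda>q. q \<circ>\<^sub>p [:1, 1:]"
  have "?E ([:0, 1:] * P (Suc n)) = [:1, 1:] * ?E (P (Suc n))"
    by (simp add: pcompose_mult pcompose_pCons)
  then have shifted: "[:1, 1:] * ?E (P (Suc n)) = ?E (P (Suc (Suc n))) +
      smult (b (Suc n)) (?E (P (Suc n))) + smult (A (Suc n)) (?E (P n))"
    by (simp only: recurrence_Suc pcompose_add pcompose_smult)
  have "L (P n * ([:1, 1:] * ?E (P (Suc n)))) =
      T (Suc (Suc n)) n + b (Suc n) * T (Suc n) n + A (Suc n) * T n n"
    by (simp only: shifted) (simp add: T_def distrib_left L_add L_smult)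
  \<comment> \<open>Now \<open>x + 1\<close> is absorbed by the unshifted factor \<open>P n\<close>,
    so the recurrence is used at \<open>x\<close> and the 1 joins \<open>b n\<close>.\<close>
  moreover have "L (P n * ([:1, 1:] * ?E (P (Suc n)))) =
      T (Suc n) (Suc n) + (b n + 1) * T (Suc n) n +
        A n * (if n = 0 then 0 else T (Suc n) (n - 1))"
  proof -
    have "[:1, 1:] = 1 + [:0, 1 :: real:]" by (simp add: one_pCons)
    then have "P n * ([:1, 1:] * ?E (P (Suc n))) =
        (P n + [:0, 1:] * P n) * ?E (P (Suc n))"
      by (simp only: distrib_right distrib_left mult_1_left mult_ac)
    also have "[:0, 1:] * P n =
        P (Suc n) + smult (b n) (P n) + smult (A n) (if n = 0 then 0 else P (n - 1))"
      using rec by (simp add: recurrence_coeffs_def)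
    finally show ?thesis
      by (cases n) (simp_all add: T_def distrib_right distrib_left L_add L_smult)
  qed
  ultimately have "a * (T (Suc (Suc n)) n + b (Suc n) * T (Suc n) n + A (Suc n) * T n n) =
      a * (T (Suc n) (Suc n) + (b n + 1) * T (Suc n) n
        + A n * (if n = 0 then 0 else T (Suc n) (n - 1)))"
    by simp
  \<comment> \<open>At \<open>n = 0\<close> both sides vanish because
    \<open>A 0 = 0\<close>.\<close>
  moreover have "a * (A n * (if n = 0 then 0 else T (Suc n) (n - 1))) = A n * h (Suc n)"
    using T_sub2[of "n - 1"] by (cases n) (simp_all add: A_0 mult.left_commute)
  ultimately have "h (Suc (Suc n)) + a * b (Suc n) * real (Suc n) * h n + a * A (Suc n) * h n =
      a * h (Suc n) + a * (b n + 1) * real (Suc n) * h n + A n * h (Suc n)"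
    using T_sub2[of n] by (simp add: T_sub1 T_diag distrib_left mult.assoc del: of_nat_Suc)
  then have "(a * real (Suc n) * (b n - b (Suc n) + 1)) * h n =
      (A (Suc n) * (A (Suc (Suc n)) - A n)) * h n"
    by (simp add: recurrence_A_h[OF rec] algebra_simps del: of_nat_Suc)
  then show ?thesis using h_pos[of n] by (metis less_irrefl mult_right_cancel)
qed

lemma L_x: "L [:0, 1:] = b 0 * L 1"
  using L_P_P[of 1 0] by (subst recurrence_0) (simp add: L_add P_0 L_smult[of "b 0" 1, simplified])

text \<open>The second moment comes from \<open>x * x = x * P 1 + b 0 * x\<close>; only the
  \<open>A 1\<close> term of \<open>x * P 1\<close> survives under \<open>L\<close>.\<close>

lemma second_equation_0: "A 1 - a + b 0 ^ 2 + (\<beta> - 1) * b 0 = 0"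
proof -
  have "[:0, 1:] * P 1 + smult (b 0) [:0, 1:] + smult (\<beta> - 1) [:0, 1:] =
      [:0, 1:] * (P 1 + [:b 0:]) + smult (\<beta> - 1) [:0, 1:]"
    by (simp add: distrib_left)
  also have "\<dots> = [:0, \<beta> - 1, 1:] * 1"
    by (simp only: recurrence_0[symmetric]) simp
  finally have "a * L 1 = L ([:0, 1:] * P 1 + smult (b 0) [:0, 1:] + smult (\<beta> - 1) [:0, 1:])"
    using pearson[of 1] by (simp only: pcompose_1)
  also have "\<dots> = L ([:0, 1:] * P 1) + b 0 * (b 0 * L 1) + (\<beta> - 1) * (b 0 * L 1)"
    by (simp only: L_add L_smult L_x)
  also have "[:0, 1:] * P 1 = P 2 + smult (b 1) (P 1) + smult (A 1) 1"
    using recurrence_Suc[of 0] by (simp only: P_0 One_nat_def numeral_2_eq_2)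
  also have "L \<dots> = A 1 * L 1"
    using L_P_P[of 2 0] L_P_P[of 1 0] by (simp only: L_add L_smult P_0) simp
  finally have "(A 1 - a + b 0 ^ 2 + (\<beta> - 1) * b 0) * L 1 = 0"
    by (simp add: algebra_simps power2_eq_square)
  then show ?thesis using h_pos[of 0] by (simp add: P_0)
qed

lemma second_equation:
  "(A (Suc n) - a) * (A n - a) = a * (b n - real n) * (b n - real n + \<beta> - 1)"
proof (induction n)
  case 0
  have "A 1 - a = - (b 0 * (b 0 + \<beta> - 1))"
    using second_equation_0 by (simp add: algebra_simps power2_eq_square)
  then show ?case by (simp add: A_0)
next
  case (Suc n)
  define y z where "y = b n - real n" and "z = b (Suc n) - real (Suc n)"
  \<comment> \<open>The bracket of \<open>first_equation\<close> in the variables \<open>y\<close>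
    and \<open>z\<close>.\<close>
  define s where "s = y + z + real n + \<beta>"
  have f: "A (Suc n) * s = a * (real n + 1)"
    using first_equation[of n] by (simp add: y_def z_def s_def algebra_simps)
  have "A (Suc n) * (A (Suc (Suc n)) - A n) = a * (real n + 1) * (y - z)"
    using compatibility[of n] by (simp add: y_def z_def algebra_simps)
  \<comment> \<open>Trading \<open>a * (n + 1)\<close> for \<open>A (Suc n) * s\<close> makes the
    positive factor \<open>A (Suc n)\<close> cancel.\<close>
  also have "\<dots> = A (Suc n) * (s * (y - z))"
    by (simp flip: f)
  finally have c: "A (Suc (Suc n)) - A n = s * (y - z)"
    using recurrence_A_pos[OF rec, of n] by simp
  have "(A (Suc (Suc n)) - a) * (A (Suc n) - a) - a * z * (z + \<beta> - 1) =
      (A (Suc n) - a) * (A n - a) - a * y * (y + \<beta> - 1)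
      + (A (Suc n) - a) * (A (Suc (Suc n)) - A n) + a * (y - z) * (y + z + \<beta> - 1)"
    by (simp add: algebra_simps)
  also have "\<dots> = (A (Suc n) - a) * (s * (y - z)) + a * (y - z) * (y + z + \<beta> - 1)"
    using Suc.IH by (simp add: c y_def)
  \<comment> \<open>The increment of the invariant has a factor that is zero by
    \<open>f\<close>.\<close>
  also have "\<dots> = (y - z) * (A (Suc n) * s - a * (real n + 1))"
    by (simp add: s_def algebra_simps)
  finally show ?case by (simp add: f z_def)
qed

section \<open>The initial value as a quotient of Bessel functions\<close>

lemma Gamma_add_nat: "Gamma (\<beta> + real k) = pochhammer \<beta> k * Gamma \<beta>"
proof -
  have "\<beta> \<notin> \<int>\<^sub>\<le>\<^sub>0" using \<beta>_pos by (auto dest: nonpos_Ints_nonpos)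
  moreover have "Gamma \<beta> > 0" using \<beta>_pos by (rule Gamma_real_pos)
  ultimately show ?thesis using pochhammer_Gamma[of \<beta> k] by simp
qed

lemma bessel_sub1: "bessel_I (\<beta> - 1) (2 * sqrt a) = sqrt a powr (\<beta> - 1) / Gamma \<beta> * L 1"
proof -
  have "(2 * sqrt a / 2) powr (2 * real k + (\<beta> - 1)) / (fact k * Gamma (real k + (\<beta> - 1) + 1)) =
      sqrt a powr (\<beta> - 1) / Gamma \<beta> * (poly 1 (real k) * charlier_weight a \<beta> k)" for k
  proof -
    have "sqrt a powr (2 * real k) = a ^ k"
      using a_pos by (simp add: powr_powr powr_half_sqrt[symmetric] powr_realpow)
    moreover have "Gamma (real k + \<beta>) = pochhammer \<beta> k * Gamma \<beta>"
      using Gamma_add_nat[of k] by (simp add: add.commute)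
    ultimately show ?thesis by (simp add: powr_add charlier_weight_def mult_ac)
  qed
  then show ?thesis
    unfolding bessel_I_def L_def by (simp only: suminf_mult[OF summable_poly])
qed

text \<open>In the first moment the term at 0 vanishes and \<open>k / k!\<close> is
  \<open>1 / (k - 1)!\<close>, so shifting the index gives the Bessel series; the shift accounts for
  the factor \<open>a\<close>.\<close>

lemma bessel_main: "a * bessel_I \<beta> (2 * sqrt a) = sqrt a powr \<beta> / Gamma \<beta> * L [:0, 1:]"
proof -
  let ?w = "charlier_weight a \<beta>"
  let ?g = "\<lambda>k. (2 * sqrt a / 2) powr (2 * real k + \<beta>) / (fact k * Gamma (real k + \<beta> + 1))"
  let ?f = "\<lambda>k. poly [:0, 1:] (real k) * ?w k"
  have g: "?g k = sqrt a powr \<beta> / Gamma \<beta> / a * ?f (Suc k)" for k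
  proof -
    have "sqrt a powr (2 * real k) = a ^ k"
      using a_pos by (simp add: powr_powr powr_half_sqrt[symmetric] powr_realpow)
    moreover have "Gamma (real k + \<beta> + 1) = pochhammer \<beta> (Suc k) * Gamma \<beta>"
      using Gamma_add_nat[of "Suc k"] by (simp add: add_ac)
    ultimately show ?thesis
      using a_pos by (simp add: powr_add charlier_weight_def mult_ac del: of_nat_Suc)
  qed
  have s: "summable (\<lambda>k. ?f (Suc k))"
    using summable_poly[of "[:0, 1:]"] by (subst summable_Suc_iff)
  have "bessel_I \<beta> (2 * sqrt a) = (\<Sum>k. sqrt a powr \<beta> / Gamma \<beta> / a * ?f (Suc k))"
    unfolding bessel_I_def by (simp only: g)
  also have "\<dots> = sqrt a powr \<beta> / Gamma \<beta> / a * (\<Sum>k. ?f (Suc k))"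
    by (rule suminf_mult[OF s])
  also have "(\<Sum>k. ?f (Suc k)) = L [:0, 1:]"
    unfolding L_def using suminf_split_head[OF summable_poly[of "[:0, 1:]"]] by simp
  finally show ?thesis using a_pos by simp
qed

text \<open>By \<open>L_x\<close>, \<open>b 0\<close> is the first moment over the total mass; the
  Bessel prefactors of the two differ by \<open>sqrt a\<close>.\<close>

lemma b_0: "b 0 = sqrt a * bessel_I \<beta> (2 * sqrt a) / bessel_I (\<beta> - 1) (2 * sqrt a)"
proof -
  have L1: "L 1 > 0" using h_pos[of 0] by (simp add: P_0)
  have G: "Gamma \<beta> > 0" using \<beta>_pos by (rule Gamma_real_pos)
  have p: "sqrt a powr \<beta> = sqrt a powr (\<beta> - 1) * sqrt a"
    using a_pos powr_add[of "sqrt a" "\<beta> - 1" 1] by simp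
  have "a * (sqrt a * bessel_I \<beta> (2 * sqrt a)) = a * (b 0 * bessel_I (\<beta> - 1) (2 * sqrt a))"
    using a_pos by (simp add: mult.left_commute[of a] bessel_main bessel_sub1 L_x p)
  moreover have "bessel_I (\<beta> - 1) (2 * sqrt a) > 0"
    using L1 G a_pos by (simp add: bessel_sub1)
  ultimately show ?thesis using a_pos by (simp add: field_simps)
qed

end

theorem theorem2p1:
  fixes a \<beta> :: real and P :: "nat \<Rightarrow> real poly" and A b :: "nat \<Rightarrow> real"
  assumes "a > 0" and "\<beta> > 0"
    and "monic_orthogonal_polys (charlier_weight a \<beta>) P"
    and "recurrence_coeffs P A b"
  shows "(\<forall>n\<ge>1. b n + b (n - 1) - real n + \<beta> = a * real n / A n) \<and>
         (\<forall>n. (A (n + 1) - a) * (A n - a) = a * (b n - real n) * (b n - real n + \<beta> - 1)) \<and>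
         A 0 = 0 \<and>
         b 0 = sqrt a * bessel_I \<beta> (2 * sqrt a) / bessel_I (\<beta> - 1) (2 * sqrt a)"
proof -
  interpret charlier_polys a \<beta> P A b
    using assms by unfold_locales
  have "b n + b (n - 1) - real n + \<beta> = a * real n / A n" if "1 \<le> n" for n
  proof -
    obtain m where n: "n = Suc m" using \<open>1 \<le> n\<close> by (cases n) auto
    have "A n > 0" using recurrence_A_pos[OF rec] n by simp
    with first_equation[of m] show ?thesis
      by (simp add: n eq_divide_eq mult.commute del: of_nat_Suc)
  qed
  with second_equation A_0 b_0 show ?thesis by simp
qed

end
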